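(* Let $X$ be a sequentially weakly closed subset of a reflexive and separable real Banach space, let $k$ be a positive integer, and let $\Psi:X\to\,]-\infty,+\infty]$ be a sequentially weakly lower semicontinuous functional such that, for some real $r>\inf_X\Psi$, the set $\Psi^{-1}(]-\infty,r[)$ is bounded. Suppose that there are a functional $\Phi:X\to\mathbf R$, bounded below in $(\overline{\Psi^{-1}(]-\infty,r[)})_w$, and a sequence $\{\mu_n\}$ in $\mathbf R^+$ converging to $0$ such that, for each $\lambda>0$ small enough, the functional $\Psi+\lambda\Phi$ is sequentially weakly lower semicontinuous, and, for each $n\in\mathbf N$, the functional $\Psi+\mu_n\Phi$ has at most $k$ $\tau_\Psi$-local minima lying in $\Psi^{-1}(]-\infty,r[)$, where $\tau$ is the relative weak topology of $X$. Then, for every $\rho\in\,]\inf_X\Psi,r]$, the sets $(\overline{\Psi^{-1}(]-\infty,\rho[)})_w$ and $\Psi^{-1}(\inf_X\Psi)$ have at most $k$ weakly connected components. So, in particular, these sets are weakly connected when $k=1$.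
   Context: $\mathbf R^+=\,]0,+\infty[$. For a set $A$ in a Banach space, $(\overline A)_w$ denotes its closure in the weak topology; $A$ is weakly connected if it is connected in the weak topology, and its weakly connected components are its connected components in the weak topology. For a topology $\tau$ on $X$ and $\Psi:X\to\,]-\infty,+\infty]$ not identically $+\infty$, $\tau_\Psi$ denotes the smallest topology on $X$ containing both $\tau$ and the family of sets $\{\Psi^{-1}(]-\infty,s[)\}_{s\in\mathbf R}$. A $\tau_\Psi$-local minimum of a function $F$ on $X$ is a point $x\in X$ such that $F(x)\le F(y)$ for all $y$ in some $\tau_\Psi$-neighbourhood of $x$. "For each $\lambda>0$ small enough" means: there is $\lambda'>0$ such that the property holds for all $\lambda\in\,]0,\lambda']$. *)

theory Defs
  imports "HOL-Analysis.Analysis"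
begin

definition weak_top :: "'a::real_normed_vector topology" where
  "weak_top = topology_generated_by
     {blinfun_apply f -` U | (f :: 'a \<Rightarrow>\<^sub>L real) U. open U}"

definition bidual_embed :: "'a::real_normed_vector \<Rightarrow> ('a \<Rightarrow>\<^sub>L real) \<Rightarrow>\<^sub>L real" where
  "bidual_embed x = Blinfun (\<lambda>f. blinfun_apply f x)"

definition reflexive_space :: "'a::real_normed_vector itself \<Rightarrow> bool" where
  "reflexive_space _ \<longleftrightarrow> surj (bidual_embed :: 'a \<Rightarrow> ('a \<Rightarrow>\<^sub>L real) \<Rightarrow>\<^sub>L real)"

definition seq_closedin :: "'a topology \<Rightarrow> 'a set \<Rightarrow> bool" where
  "seq_closedin T S \<longleftrightarrow> S \<subseteq> topspace T \<and>
     (\<forall>s l. (\<forall>n. s n \<in> S) \<longrightarrow> limitin T s l sequentially \<longrightarrow> l \<in> S)"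

definition seq_lsc :: "'a topology \<Rightarrow> ('a \<Rightarrow> ereal) \<Rightarrow> bool" where
  "seq_lsc T F \<longleftrightarrow>
     (\<forall>s l. (\<forall>n. s n \<in> topspace T) \<longrightarrow> limitin T s l sequentially \<longrightarrow>
        F l \<le> liminf (\<lambda>n. F (s n)))"

text \<open>The coarsest topology on the underlying set of \<open>T\<close> that contains \<open>T\<close> and all strict real
  sublevel sets of \<open>F\<close>.\<close>

definition sublevel_top :: "'a topology \<Rightarrow> ('a \<Rightarrow> ereal) \<Rightarrow> 'a topology" where
  "sublevel_top T F = topology_generated_by
     ({U. openin T U} \<union> {{x \<in> topspace T. F x < ereal s} | s :: real. True})"

definition local_min_in :: "'a topology \<Rightarrow> ('a \<Rightarrow> ereal) \<Rightarrow> 'a \<Rightarrow> bool" where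
  "local_min_in T F x \<longleftrightarrow> (\<exists>U. openin T U \<and> x \<in> U \<and> (\<forall>y\<in>U. F x \<le> F y))"

lemma bidual_embed_apply [simp]: "blinfun_apply (bidual_embed x) f = blinfun_apply f x"
  unfolding bidual_embed_def
  by (simp add: bounded_linear_Blinfun_apply blinfun.bounded_linear_left)

lemma topspace_weak_top [simp]: "topspace weak_top = UNIV"
  unfolding weak_top_def by auto

lemma topspace_sublevel_top [simp]: "topspace (sublevel_top T F) = topspace T"
  unfolding sublevel_top_def by (auto dest: openin_subset)

lemma limitin_weak_top:
  "limitin weak_top s l F \<longleftrightarrow>
     (\<forall>f :: 'a::real_normed_vector \<Rightarrow>\<^sub>L real. ((\<lambda>n. blinfun_apply f (s n)) \<longlongrightarrow> blinfun_apply f l) F)"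
proof (intro iffI allI)
  fix f :: "'a \<Rightarrow>\<^sub>L real"
  assume lim: "limitin weak_top s l F"
  show "((\<lambda>n. blinfun_apply f (s n)) \<longlongrightarrow> blinfun_apply f l) F"
  proof (rule topological_tendstoI)
    fix U :: "real set" assume U: "open U" "blinfun_apply f l \<in> U"
    have "openin weak_top (blinfun_apply f -` U)"
      unfolding weak_top_def using U by (intro topology_generated_by_Basis) auto
    then show "\<forall>\<^sub>F n in F. blinfun_apply f (s n) \<in> U"
      using lim U unfolding limitin_def by auto
  qed
next
  assume lim: "\<forall>f :: 'a \<Rightarrow>\<^sub>L real. ((\<lambda>n. blinfun_apply f (s n)) \<longlongrightarrow> blinfun_apply f l) F"
  have "l \<in> U \<longrightarrow> (\<forall>\<^sub>F n in F. s n \<in> U)"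
    if "generate_topology_on {blinfun_apply f -` V | (f :: 'a \<Rightarrow>\<^sub>L real) V. open V} U" for U
    using that
  proof (induction rule: generate_topology_on.induct)
    case Empty then show ?case by simp
  next
    case (Int a b) then show ?case by (auto simp: eventually_conj_iff)
  next
    case (UN K)
    show ?case
    proof
      assume "l \<in> \<Union>K"
      then obtain k where "k \<in> K" "l \<in> k" by auto
      with UN have "\<forall>\<^sub>F n in F. s n \<in> k" by auto
      then show "\<forall>\<^sub>F n in F. s n \<in> \<Union>K"
        by (rule eventually_mono) (use \<open>k \<in> K\<close> in auto)
    qed
  next
    case (Basis a)
    then obtain f :: "'a \<Rightarrow>\<^sub>L real" and V where "open V" and a: "a = blinfun_apply f -` V" by auto
    then show ?case using lim topological_tendstoD[of "\<lambda>n. blinfun_apply f (s n)"] by auto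
  qed
  then show "limitin weak_top s l F"
    unfolding limitin_def by (simp add: weak_top_def openin_topology_generated_by_iff) auto
qed

end

theory Submission
  imports Defs
begin

text \<open>Write \<open>A\<^sub>\<rho>\<close> for the strict sublevel set \<open>{\<Psi> < \<rho>}\<close> and \<open>C\<^sub>\<rho>\<close> for its weak closure. Everything
  takes place in \<open>C\<^sub>r\<close>, which is weakly compact because \<open>A\<^sub>r\<close> is bounded and the space is
  reflexive (\<open>compactin_weak_polar\<close>), and weakly metrizable because countably many functionals
  separate the points of a separable space (\<open>metrizable_weakly_compact\<close>). Metrizability is what turns
  the sequential hypotheses into topological ones: \<open>C\<^sub>r\<close> lies in \<open>X\<close>, sequentially lower
  semicontinuous functionals have closed sublevel sets in \<open>C\<^sub>r\<close>, and so they attain their minimum on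
  every nonempty closed subset of \<open>C\<^sub>r\<close>. Both the separation of points by functionals and the norming
  functionals behind the countable family come from a Hahn-Banach argument.

  Suppose \<open>C\<^sub>\<rho>\<close> is cut into finitely many nonempty clopen pieces. Each piece \<open>V\<close> is open in the
  closure of \<open>A\<^sub>\<rho>\<close>, so it contains a point \<open>a\<close> with \<open>\<Psi> a < \<rho>\<close>. Let \<open>b\<close> be a lower bound
  of \<open>\<Phi>\<close> on \<open>C\<^sub>r\<close>. Once \<open>\<mu>\<close> is so small that \<open>\<mu> (\<Phi> a - b) < \<rho> - \<Psi> a\<close>, a
  minimiser \<open>x\<close> of \<open>\<Psi> + \<mu> \<Phi>\<close> over \<open>V\<close> satisfies
  \<open>\<Psi> x + \<mu> \<Phi> x \<le> \<Psi> a + \<mu> \<Phi> a < \<rho> + \<mu> b \<le> \<rho> + \<mu> \<Phi> x\<close>, that is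
  \<open>\<Psi> x < \<rho>\<close>. Since \<open>V \<inter> A\<^sub>\<rho>\<close> is open in the topology refined by the sublevel sets of
  \<open>\<Psi>\<close>, the point \<open>x\<close> is a local minimum there. As \<open>\<mu>\<^sub>n \<rightarrow> 0\<close>, one index \<open>n\<close> serves
  all pieces at once, and disjoint pieces give distinct local minima; hence there are at most \<open>k\<close>
  pieces (\<open>card_pieces_le\<close>). A space all of whose finite clopen partitions have at most \<open>k\<close> members
  has at most \<open>k\<close> components (\<open>card_components_le\<close>).

  The set of global minimisers is the intersection of the compact sets \<open>C\<^sub>\<rho>\<close> as \<open>\<rho>\<close> decreases to
  the infimum. A clopen partition of it extends, by normality, to disjoint open sets, and by
  compactness these cover \<open>C\<^sub>\<rho>\<close> for some \<open>\<rho>\<close> above the infimum; so they cut this \<open>C\<^sub>\<rho>\<close> into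
  equally many clopen pieces (\<open>components_minimisers\<close>).\<close>

section \<open>Norming functionals\<close>

definition sublinear :: "('a::real_vector \<Rightarrow> real) \<Rightarrow> bool" where
  "sublinear q \<longleftrightarrow> (\<forall>x y. q (x + y) \<le> q x + q y) \<and> (\<forall>c>0. \<forall>x. q (c *\<^sub>R x) = c * q x)"

lemma sublinear_add: "sublinear q \<Longrightarrow> q (x + y) \<le> q x + q y"
  and sublinear_scale: "sublinear q \<Longrightarrow> c > 0 \<Longrightarrow> q (c *\<^sub>R x) = c * q x"
  by (auto simp: sublinear_def)

lemma sublinear_zero: "sublinear q \<Longrightarrow> q 0 = 0"
  using sublinear_scale[of q 2 0] by simp

lemma sublinear_minus: "sublinear q \<Longrightarrow> - q (- x) \<le> q x"
  using sublinear_add[of q x "- x"] sublinear_zero[of q] by simp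

text \<open>The infimum over \<open>t \<ge> 0\<close> is the largest sublinear minorant of \<open>q\<close> whose value at
  \<open>- x\<close> is at most \<open>- q x\<close>. Passing to it is the one step from which both halves of the
  Hahn-Banach argument are made: it pins the value at a prescribed point, and a sublinear function
  that it leaves unchanged in every direction is additive.\<close>

definition slope_along :: "('a::real_vector \<Rightarrow> real) \<Rightarrow> 'a \<Rightarrow> 'a \<Rightarrow> real" where
  "slope_along q x y = (INF t\<in>{0..}. q (y + t *\<^sub>R x) - t * q x)"

lemma slope_along_le:
  assumes q: "sublinear q" and t: "t \<ge> 0"
  shows "slope_along q x y \<le> q (y + t *\<^sub>R x) - t * q x"
  unfolding slope_along_def
proof (rule cINF_lower)
  \<comment> \<open>subadditivity keeps the infimum finite\<close>
  have "- q (- y) \<le> q (y + s *\<^sub>R x) - s * q x" if "s \<ge> 0" for s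
  proof (cases "s = 0")
    case True
    then show ?thesis using sublinear_minus[OF q] by simp
  next
    case False
    then have "s * q x = q ((y + s *\<^sub>R x) + - y)"
      using sublinear_scale[OF q] that by simp
    then show ?thesis using sublinear_add[OF q, of "y + s *\<^sub>R x" "- y"] by linarith
  qed
  then show "bdd_below ((\<lambda>t. q (y + t *\<^sub>R x) - t * q x) ` {0..})"
    by (intro bdd_belowI[of _ "- q (- y)"]) auto
qed (use t in auto)

lemma slope_along_greatest:
  assumes "\<And>t. t \<ge> 0 \<Longrightarrow> c \<le> q (y + t *\<^sub>R x) - t * q x"
  shows "c \<le> slope_along q x y"
  unfolding slope_along_def using assms by (intro cINF_greatest) auto

lemma slope_along_below: "sublinear q \<Longrightarrow> slope_along q x y \<le> q y"
  using slope_along_le[of q 0 x y] by simp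

lemma sublinear_slope_along:
  assumes q: "sublinear q"
  shows "sublinear (slope_along q x)"
proof -
  have add: "slope_along q x (y + z) \<le> slope_along q x y + slope_along q x z" for y z
  proof -
    have 1: "slope_along q x (y + z) \<le> (q (y + s *\<^sub>R x) - s * q x) + (q (z + t *\<^sub>R x) - t * q x)"
      if "s \<ge> 0" "t \<ge> 0" for s t
    proof -
      have "q (y + z + (s + t) *\<^sub>R x) \<le> q (y + s *\<^sub>R x) + q (z + t *\<^sub>R x)"
        using sublinear_add[OF q, of "y + s *\<^sub>R x" "z + t *\<^sub>R x"] by (simp add: algebra_simps)
      then show ?thesis
        using slope_along_le[OF q, of "s + t" x "y + z"] that by (simp add: algebra_simps)
    qed
    have "slope_along q x (y + z) - (q (y + s *\<^sub>R x) - s * q x) \<le> slope_along q x z"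
      if "s \<ge> 0" for s
      using 1[OF that] by (intro slope_along_greatest) (simp add: diff_le_eq add.commute)
    then have "slope_along q x (y + z) - slope_along q x z \<le> slope_along q x y"
      by (intro slope_along_greatest) (simp add: algebra_simps)
    then show ?thesis by simp
  qed
  have half: "c * slope_along q x y \<le> slope_along q x (c *\<^sub>R y)" if c: "c > 0" for c y
  proof (rule slope_along_greatest)
    fix t :: real assume t: "t \<ge> 0"
    have "c *\<^sub>R y + t *\<^sub>R x = c *\<^sub>R (y + (t / c) *\<^sub>R x)"
      using c by (simp add: algebra_simps)
    then have "q (c *\<^sub>R y + t *\<^sub>R x) = c * q (y + (t / c) *\<^sub>R x)"
      by (simp only: sublinear_scale[OF q c])
    then have "q (c *\<^sub>R y + t *\<^sub>R x) - t * q x = c * (q (y + (t / c) *\<^sub>R x) - (t / c) * q x)"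
      using c by (simp add: algebra_simps)
    moreover have "slope_along q x y \<le> q (y + (t / c) *\<^sub>R x) - (t / c) * q x"
      using c t by (intro slope_along_le[OF q]) simp
    ultimately show "c * slope_along q x y \<le> q (c *\<^sub>R y + t *\<^sub>R x) - t * q x"
      using c by (metis mult_le_cancel_left_pos)
  qed
  have "slope_along q x (c *\<^sub>R y) = c * slope_along q x y" if c: "c > 0" for c y
  proof (rule antisym[OF _ half[OF c]])
    have "(1 / c) * slope_along q x (c *\<^sub>R y) \<le> slope_along q x y"
      using half[of "1 / c" "c *\<^sub>R y"] c by simp
    then show "slope_along q x (c *\<^sub>R y) \<le> c * slope_along q x y"
      using c by (simp add: field_simps)
  qed
  with add show ?thesis unfolding sublinear_def by blast
qed

text \<open>Zorn's lemma applies downwards, since the pointwise infimum of a chain is again sublinear: it is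
  finite because every \<open>q \<le> p\<close> satisfies \<open>q x \<ge> - p (- x)\<close>, and it is subadditive because two
  members of a chain have a common lower bound in the chain.\<close>

lemma minimal_sublinear_below:
  assumes p: "sublinear p"
  obtains q where "sublinear q" "q \<le> p" "\<And>q'. sublinear q' \<Longrightarrow> q' \<le> q \<Longrightarrow> q' = q"
proof -
  define S where "S = {q. sublinear q \<and> q \<le> p}"
  have "\<exists>m\<in>S. \<forall>a\<in>S. a \<le> m \<longrightarrow> a = m"
  proof (rule predicate_Zorn)
    show "partial_order_on S (relation_of (\<lambda>a b. b \<le> a) S)"
      by (rule partial_order_on_relation_ofI) auto
    fix C assume "C \<in> Chains (relation_of (\<lambda>a b. b \<le> a) S)"
    then have C: "a \<in> S" "a \<le> b \<or> b \<le> a" if "a \<in> C" "b \<in> C" for a b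
      using that by (auto simp: Chains_def relation_of_def)
    show "\<exists>u\<in>S. \<forall>a\<in>C. u \<le> a"
    proof (cases "C = {}")
      case True
      then show ?thesis using p by (auto simp: S_def)
    next
      case False
      define u where "u = (\<lambda>x. INF q\<in>C. q x)"
      have bdd: "bdd_below ((\<lambda>q. q x) ` C)" for x
      proof (rule bdd_belowI2)
        fix q assume "q \<in> C"
        then have "sublinear q" "q (- x) \<le> p (- x)" using C by (auto simp: S_def le_fun_def)
        then show "- p (- x) \<le> q x" using sublinear_minus[of q x] by linarith
      qed
      have u_le: "u x \<le> q x" if "q \<in> C" for q x
        unfolding u_def by (rule cINF_lower[OF bdd that])
      have u_greatest: "c \<le> u x" if "\<And>q. q \<in> C \<Longrightarrow> c \<le> q x" for c x
        unfolding u_def using False that by (rule cINF_greatest)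
      have add: "u (x + y) \<le> u x + u y" for x y
      proof -
        have 1: "u (x + y) \<le> q x + q' y" if qC: "q \<in> C" "q' \<in> C" for q q'
        proof -
          obtain a where "a \<in> C" "a \<le> q" "a \<le> q'" using C(2)[OF qC] qC by (meson order_refl)
          then have "u (x + y) \<le> a x + a y"
            using u_le[of a "x + y"] sublinear_add[of a x y] C by (force simp: S_def)
          then show ?thesis using \<open>a \<le> q\<close> \<open>a \<le> q'\<close> by (smt (verit) le_fun_def)
        qed
        have "u (x + y) - q x \<le> u y" if "q \<in> C" for q
          using 1[OF that] by (intro u_greatest) (simp add: diff_le_eq add.commute)
        then have "u (x + y) - u y \<le> u x"
          by (intro u_greatest) (simp add: algebra_simps)
        then show ?thesis by simp
      qed
      have half: "c * u x \<le> u (c *\<^sub>R x)" if c: "c > 0" for c x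
      proof (rule u_greatest)
        fix q assume "q \<in> C"
        then have "q (c *\<^sub>R x) = c * q x" using C c by (auto simp: S_def sublinear_scale)
        then show "c * u x \<le> q (c *\<^sub>R x)" using c u_le[OF \<open>q \<in> C\<close>] by simp
      qed
      have "u (c *\<^sub>R x) = c * u x" if c: "c > 0" for c x
      proof (rule antisym[OF _ half[OF c]])
        show "u (c *\<^sub>R x) \<le> c * u x"
          using half[of "1 / c" "c *\<^sub>R x"] c by (simp add: field_simps)
      qed
      with add have "sublinear u" unfolding sublinear_def by blast
      moreover have "u \<le> p"
      proof -
        obtain q where "q \<in> C" using False by blast
        then have "u \<le> q" "q \<le> p" using u_le C by (auto simp: le_fun_def S_def)
        then show ?thesis by simp
      qed
      ultimately show ?thesis using u_le by (auto simp: S_def le_fun_def)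
    qed
  qed
  then obtain m where m: "m \<in> S" "\<And>a. a \<in> S \<Longrightarrow> a \<le> m \<Longrightarrow> a = m" by blast
  show thesis
  proof (rule that[of m])
    fix q' assume q': "sublinear q'" "q' \<le> m"
    then have "q' \<in> S" using m(1) by (auto simp: S_def intro: order_trans)
    then show "q' = m" using m(2) q' by blast
  qed (use m in \<open>auto simp: S_def\<close>)
qed

text \<open>Minimality forces \<open>slope_along q x = q\<close>; reading this at \<open>t = 1\<close> gives
  \<open>q y + q x \<le> q (x + y)\<close>, the reverse of subadditivity.\<close>

lemma linear_minimal_sublinear:
  assumes q: "sublinear q" and min: "\<And>q'. sublinear q' \<Longrightarrow> q' \<le> q \<Longrightarrow> q' = q"
  shows "linear q"
proof -
  have add: "q (x + y) = q x + q y" for x y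
  proof (rule antisym)
    have "slope_along q x = q"
      using sublinear_slope_along[OF q] slope_along_below[OF q]
      by (intro min) (auto simp: le_fun_def)
    then have "q y \<le> q (y + 1 *\<^sub>R x) - 1 * q x"
      using slope_along_le[OF q, of 1 x y] by simp
    then show "q x + q y \<le> q (x + y)" by (simp add: add.commute)
  qed (rule sublinear_add[OF q])
  have neg: "q (- x) = - q x" for x
    using add[of x "- x"] sublinear_zero[OF q] by simp
  have "q (c *\<^sub>R x) = c * q x" for c x
  proof (cases c "0::real" rule: linorder_cases)
    case less
    then have "q (- (c *\<^sub>R x)) = - c * q x" using sublinear_scale[OF q, of "- c" x] by simp
    then show ?thesis using neg by simp
  qed (use sublinear_scale[OF q] sublinear_zero[OF q] in auto)
  with add show ?thesis by (intro linearI) auto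
qed

text \<open>Starting from \<open>slope_along norm x\<close> rather than from the norm itself ensures that every smaller
  linear functional \<open>q\<close> has \<open>q (- x) \<le> - norm x\<close>, so that it attains the norm at \<open>x\<close>.\<close>

theorem norming_functional:
  fixes x :: "'a::real_normed_vector"
  obtains f :: "'a \<Rightarrow>\<^sub>L real" where "blinfun_apply f x = norm x" "\<And>y. \<bar>blinfun_apply f y\<bar> \<le> norm y"
proof -
  have n: "sublinear (norm :: 'a \<Rightarrow> real)"
    by (auto simp: sublinear_def norm_triangle_ineq)
  obtain q where q: "sublinear q" "q \<le> slope_along norm x"
      "\<And>q'. sublinear q' \<Longrightarrow> q' \<le> q \<Longrightarrow> q' = q"
    using minimal_sublinear_below[OF sublinear_slope_along[OF n]] by blast
  have lin: "linear q" by (rule linear_minimal_sublinear[OF q(1,3)])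
  have le: "q y \<le> norm y" for y
    using q(2) slope_along_below[OF n, of x y] by (auto simp: le_fun_def intro: order_trans)
  have abs: "\<bar>q y\<bar> \<le> norm y" for y
    using le[of y] le[of "- y"] linear_neg[OF lin, of y] by auto
  \<comment> \<open>the infimum defining \<open>slope_along norm x (- x)\<close>, estimated at \<open>t = 1\<close>\<close>
  have "q (- x) \<le> - norm x"
    using q(2) slope_along_le[OF n, of 1 x "- x"] by (auto simp: le_fun_def intro: order_trans)
  then have "q x = norm x"
    using le[of x] linear_neg[OF lin, of x] by auto
  moreover have "bounded_linear q"
    using lin abs by (intro bounded_linear_intro[of q 1]) (auto simp: linear_add linear_scale)
  ultimately show thesis
    using abs that[of "Blinfun q"] by (simp add: bounded_linear_Blinfun_apply)
qed

section \<open>The weak topology\<close>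

lemma continuous_map_weak_top: "continuous_map weak_top euclideanreal (blinfun_apply f)"
proof (unfold continuous_map_def, intro conjI allI impI)
  fix U :: "real set" assume "openin euclideanreal U"
  then have "openin weak_top (blinfun_apply f -` U)"
    unfolding weak_top_def by (intro topology_generated_by_Basis) auto
  then show "openin weak_top {x \<in> topspace weak_top. blinfun_apply f x \<in> U}"
    by (simp add: vimage_def)
qed simp

lemma eq_if_functionals_eq:
  fixes x y :: "'a::real_normed_vector"
  assumes "\<And>f :: 'a \<Rightarrow>\<^sub>L real. blinfun_apply f x = blinfun_apply f y"
  shows "x = y"
proof -
  obtain f :: "'a \<Rightarrow>\<^sub>L real" where "blinfun_apply f (x - y) = norm (x - y)"
    using norming_functional by blast
  then show ?thesis using assms by (simp add: blinfun.diff_right)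
qed

lemma Hausdorff_weak_top: "Hausdorff_space (weak_top :: 'a::real_normed_vector topology)"
  unfolding Hausdorff_space_def
proof (intro allI impI, elim conjE)
  fix x y :: 'a assume "x \<noteq> y"
  then obtain f :: "'a \<Rightarrow>\<^sub>L real" where "blinfun_apply f x \<noteq> blinfun_apply f y"
    using eq_if_functionals_eq[of x y] by blast
  then obtain U V where UV: "open U" "open V" "blinfun_apply f x \<in> U" "blinfun_apply f y \<in> V" "U \<inter> V = {}"
    using hausdorff[of "blinfun_apply f x" "blinfun_apply f y"] by auto
  have "openin weak_top (blinfun_apply f -` W)" if "open W" for W
    using openin_continuous_map_preimage[OF continuous_map_weak_top[of f], of W] that
    by (simp add: vimage_def)
  with UV show "\<exists>U V. openin weak_top U \<and> openin weak_top V \<and> x \<in> U \<and> y \<in> V \<and> disjnt U V"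
    by (intro exI[of _ "blinfun_apply f -` U"] exI[of _ "blinfun_apply f -` V"])
       (auto simp: disjnt_def)
qed

text \<open>Banach-Alaoglu in the bidual: a point is determined by its values on all functionals, and these
  values range over a product of compact intervals, in which linearity is a closed condition.
  Reflexivity says that every linear element of the product comes from a point of the space.
  For \<open>R \<ge> 0\<close> the set is the closed ball of radius \<open>R\<close>; stating it through functionals makes it the
  exact preimage of the product.\<close>

theorem compactin_weak_polar:
  fixes R :: real
  assumes refl: "reflexive_space TYPE('a::real_normed_vector)"
  shows "compactin weak_top {x :: 'a. \<forall>f. \<bar>blinfun_apply f x\<bar> \<le> R * norm f}" (is "compactin _ ?K")
proof -
  define B :: "(('a \<Rightarrow>\<^sub>L real) \<Rightarrow> real) set" where
    "B = (\<Pi>\<^sub>E f\<in>UNIV. {- (R * norm f) .. R * norm f})"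
  have B_iff: "g \<in> B \<longleftrightarrow> (\<forall>f. \<bar>g f\<bar> \<le> R * norm f)" for g
    unfolding B_def PiE_UNIV_domain Pi_iff by (simp add: abs_le_iff) (smt (verit))
  define L :: "(('a \<Rightarrow>\<^sub>L real) \<Rightarrow> real) set" where
    "L = {g. (\<forall>f h. g (f + h) = g f + g h) \<and> (\<forall>c f. g (c *\<^sub>R f) = c * g f)}"
  have "compactin (product_topology (\<lambda>f :: 'a \<Rightarrow>\<^sub>L real. euclideanreal) UNIV) B"
    unfolding B_def by (subst compactin_PiE) auto
  then have "compact B"
    by (simp add: euclidean_product_topology)
  moreover have "closed L"
    unfolding L_def
    by (intro closed_Collect_conj closed_Collect_all closed_Collect_eq continuous_intros
        continuous_on_product_coordinates)
  ultimately have "compact (B \<inter> L)" by (rule compact_Int_closed)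
  have ex: "\<exists>x. \<forall>f. blinfun_apply f x = g f" if "g \<in> B \<inter> L" for g
  proof -
    have "bounded_linear g"
    proof (rule bounded_linear_intro[of g R])
      fix f show "norm (g f) \<le> norm f * R"
        using that by (simp add: B_iff mult.commute)
    qed (use that in \<open>auto simp: L_def\<close>)
    moreover obtain x where "bidual_embed x = Blinfun g"
      using refl unfolding reflexive_space_def by (metis surjD)
    ultimately show ?thesis
      by (metis bidual_embed_apply bounded_linear_Blinfun_apply)
  qed
  \<comment> \<open>the inverse of the evaluation embedding; it is continuous by the very definition of the weak topology\<close>
  define pt where "pt = (\<lambda>g. SOME x :: 'a. \<forall>f :: 'a \<Rightarrow>\<^sub>L real. blinfun_apply f x = g f)"
  have pt: "blinfun_apply f (pt g) = g f" if "g \<in> B \<inter> L" for f g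
    unfolding pt_def using someI_ex[OF ex[OF that]] by blast
  have "continuous_map (top_of_set (B \<inter> L)) weak_top pt"
    unfolding weak_top_def
  proof (rule continuous_on_generated_topo)
    fix V :: "'a set" assume "V \<in> {blinfun_apply f -` U | (f :: 'a \<Rightarrow>\<^sub>L real) U. open U}"
    then obtain f :: "'a \<Rightarrow>\<^sub>L real" and U where U: "open U" "V = blinfun_apply f -` U" by blast
    have eq: "pt -` V \<inter> topspace (top_of_set (B \<inter> L)) = (B \<inter> L) \<inter> {g. g f \<in> U}"
      using pt U by auto
    have "open {g :: ('a \<Rightarrow>\<^sub>L real) \<Rightarrow> real. g f \<in> U}"
      using open_vimage[OF U(1) continuous_on_product_coordinates[of f]] by (simp add: vimage_def)
    then show "openin (top_of_set (B \<inter> L)) (pt -` V \<inter> topspace (top_of_set (B \<inter> L)))"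
      unfolding eq by (rule openin_open_Int)
  next
    show "pt ` topspace (top_of_set (B \<inter> L)) \<subseteq> \<Union> {blinfun_apply f -` U |f U. open U}"
      by (auto intro!: exI[of _ UNIV])
  qed
  moreover have "compactin (top_of_set (B \<inter> L)) (B \<inter> L)"
    using \<open>compact (B \<inter> L)\<close> by (simp add: compactin_subtopology)
  ultimately have "compactin weak_top (pt ` (B \<inter> L))"
    by (rule image_compactin[rotated])
  moreover have "pt ` (B \<inter> L) = ?K"
  proof (intro equalityI subsetI)
    fix x assume "x \<in> pt ` (B \<inter> L)"
    then show "x \<in> ?K" using pt by (auto simp: B_iff)
  next
    fix x assume x: "x \<in> ?K"
    define g where "g = (\<lambda>f :: 'a \<Rightarrow>\<^sub>L real. blinfun_apply f x)"
    have g: "g \<in> B \<inter> L"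
      using x by (auto simp: g_def B_iff L_def blinfun.add_left blinfun.scaleR_left)
    have "pt g = x"
      by (rule eq_if_functionals_eq) (use pt[OF g] in \<open>simp add: g_def\<close>)
    then show "x \<in> pt ` (B \<inter> L)" using g by blast
  qed
  ultimately show ?thesis by simp
qed

text \<open>Take norming functionals of a countable dense set. If all of them vanish at \<open>z\<close> and \<open>d\<close> is a
  dense point near \<open>z\<close>, then \<open>norm d\<close> is the value of a functional of norm at most one at \<open>d - z\<close>,
  so \<open>d\<close> is small, and hence so is \<open>z\<close>.\<close>

lemma countable_separating_functionals:
  assumes "separable_space (euclidean :: 'a::real_normed_vector topology)"
  obtains F :: "nat \<Rightarrow> ('a::real_normed_vector) \<Rightarrow>\<^sub>L real"
  where "\<And>x y. \<forall>n. blinfun_apply (F n) x = blinfun_apply (F n) y \<Longrightarrow> x = y"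
proof -
  obtain D :: "'a set" where D: "countable D" "closure D = UNIV"
    using assms unfolding separable_space_def by auto
  have "\<exists>f :: 'a \<Rightarrow>\<^sub>L real. blinfun_apply f d = norm d \<and> (\<forall>y. \<bar>blinfun_apply f y\<bar> \<le> norm y)" for d :: 'a
    using norming_functional by metis
  then obtain N :: "'a \<Rightarrow> 'a \<Rightarrow>\<^sub>L real" where N: "blinfun_apply (N d) d = norm d"
      "\<bar>blinfun_apply (N d) y\<bar> \<le> norm y" for d y
    by metis
  show thesis
  proof (rule that[of "\<lambda>n. N (from_nat_into D n)"])
    fix x y assume eq: "\<forall>n. blinfun_apply (N (from_nat_into D n)) x = blinfun_apply (N (from_nat_into D n)) y"
    define z where "z = x - y"
    have "norm z \<le> e" if e: "e > 0" for e
    proof -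
      obtain d where d: "d \<in> D" "dist d z < e / 2"
        using D(2) closure_approachable[of z D] half_gt_zero[OF e] by blast
      obtain n where "from_nat_into D n = d"
        using from_nat_into_surj[OF D(1) d(1)] by blast
      then have "blinfun_apply (N d) z = 0"
        using eq[rule_format, of n] by (simp add: z_def blinfun.diff_right)
      then have "norm d = blinfun_apply (N d) (d - z)"
        by (simp add: N blinfun.diff_right)
      also have "\<dots> \<le> norm (d - z)" using N(2)[of d "d - z"] by linarith
      finally have "norm d \<le> dist d z" by (simp add: dist_norm)
      moreover have "norm z \<le> norm d + dist d z"
        using norm_triangle_ineq4[of d "d - z"] by (simp add: dist_norm)
      ultimately show ?thesis using d by linarith
    qed
    then have "norm z \<le> 0" by (rule field_le_epsilon) simp
    then show "x = y" by (simp add: z_def)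
  qed
qed

text \<open>A countable separating family of functionals is a continuous injection into the metrizable space of
  real sequences, and on a compact set such a map is an embedding.\<close>

theorem metrizable_weakly_compact:
  fixes K :: "'a::real_normed_vector set"
  assumes sep: "separable_space (euclidean :: 'a topology)" and K: "compactin weak_top K"
  shows "metrizable_space (subtopology weak_top K)"
proof -
  obtain F :: "nat \<Rightarrow> 'a \<Rightarrow>\<^sub>L real"
    where F: "\<And>x y. \<forall>n. blinfun_apply (F n) x = blinfun_apply (F n) y \<Longrightarrow> x = y"
    using countable_separating_functionals[OF sep] by blast
  define E where "E = (\<lambda>x n. blinfun_apply (F n) x)"
  have "continuous_map weak_top (product_topology (\<lambda>n::nat. euclideanreal) UNIV) E"
    unfolding continuous_map_componentwise_UNIV E_def by (simp add: continuous_map_weak_top)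
  then have "continuous_map (subtopology weak_top K) (euclidean :: (nat \<Rightarrow> real) topology) E"
    by (simp add: euclidean_product_topology continuous_map_from_subtopology)
  then have "embedding_map (subtopology weak_top K) (euclidean :: (nat \<Rightarrow> real) topology) E"
    using K by (rule continuous_imp_embedding_map[OF _ compact_space_subtopology])
      (auto simp: inj_on_def E_def fun_eq_iff intro: F)
  then have "subtopology weak_top K homeomorphic_space
      subtopology (euclidean :: (nat \<Rightarrow> real) topology) (E ` topspace (subtopology weak_top K))"
    unfolding embedding_map_def by (rule homeomorphic_map_imp_homeomorphic_space)
  then show ?thesis
    using homeomorphic_metrizable_space metrizable_space_subtopology[OF metrizable_space_euclidean] by auto
qed

section \<open>Counting components with clopen sets\<close>

definition clopen_partition :: "'a topology \<Rightarrow> 'a set set \<Rightarrow> bool" where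
  "clopen_partition Y P \<longleftrightarrow> finite P \<and> pairwise disjnt P \<and> \<Union>P = topspace Y \<and>
     (\<forall>U\<in>P. U \<noteq> {} \<and> openin Y U \<and> closedin Y U)"

lemma clopen_partition_split:
  assumes P: "clopen_partition Y P" and U: "U \<in> P"
    and V: "openin Y V" "closedin Y V" "V \<subseteq> U" "V \<noteq> {}" "V \<noteq> U"
  defines "Q \<equiv> insert (U - V) (insert V (P - {U}))"
  shows "clopen_partition Y Q" and "card Q = Suc (card P)"
proof -
  have fin: "finite P" and dP: "pairwise disjnt P" and cP: "\<Union>P = topspace Y"
    and clopen: "\<And>Z. Z \<in> P \<Longrightarrow> Z \<noteq> {} \<and> openin Y Z \<and> closedin Y Z"
    using P by (auto simp: clopen_partition_def)
  have dU: "disjnt U Z" "Z \<noteq> {}" if "Z \<in> P - {U}" for Z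
    using dP U that clopen by (auto simp: pairwise_def)
  have ne: "U - V \<noteq> {}" using V by blast
  have dis: "disjnt V Z \<and> disjnt (U - V) Z" if "Z \<in> P - {U}" for Z
    using dU(1)[OF that] V(3) by (auto simp: disjnt_iff)
  then have notin: "V \<notin> P - {U}" "U - V \<notin> insert V (P - {U})"
    using V(4) ne by (auto simp: disjnt_iff)
  then have "card Q = Suc (Suc (card (P - {U})))"
    using fin by (simp add: Q_def)
  then show "card Q = Suc (card P)"
    using card_Suc_Diff1[OF fin U] by simp
  have "pairwise disjnt (P - {U})" using dP by (rule pairwise_subset) blast
  then have "pairwise disjnt Q"
    using dis unfolding Q_def pairwise_insert by (auto simp: disjnt_iff)
  moreover have "\<Union>Q = topspace Y"
    using cP U V(3) unfolding Q_def by blast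
  moreover have "\<forall>Z\<in>Q. Z \<noteq> {} \<and> openin Y Z \<and> closedin Y Z"
    using clopen U V ne by (auto simp: Q_def)
  ultimately show "clopen_partition Y Q"
    using fin by (simp add: clopen_partition_def Q_def)
qed

text \<open>A clopen partition with the largest possible number of members cannot be refined, so all its members
  are connected, and then the components are exactly these members. In particular there are finitely
  many, which is not clear beforehand because a component of a general space need not be open.\<close>

theorem card_components_le:
  assumes bound: "\<And>P. clopen_partition Y P \<Longrightarrow> card P \<le> k"
  shows "finite (connected_components_of Y) \<and> card (connected_components_of Y) \<le> k"
proof -
  have "clopen_partition Y (if topspace Y = {} then {} else {topspace Y})"
    by (simp add: clopen_partition_def)
  moreover have "\<forall>P. clopen_partition Y P \<longrightarrow> card P < Suc k"
    using bound by (simp add: less_Suc_eq_le)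
  ultimately have "\<exists>P. clopen_partition Y P \<and> (\<forall>Q. clopen_partition Y Q \<longrightarrow> card Q \<le> card P)"
    by (rule ex_has_greatest_nat)
  then obtain P where P: "clopen_partition Y P" and max: "\<And>Q. clopen_partition Y Q \<Longrightarrow> card Q \<le> card P"
    by blast
  have clopen: "openin Y U" "closedin Y U" "U \<noteq> {}" if "U \<in> P" for U
    using P that by (auto simp: clopen_partition_def)
  have conn: "connectedin Y U" if U: "U \<in> P" for U
  proof -
    have "V = {} \<or> V = U" if V: "openin (subtopology Y U) V" "closedin (subtopology Y U) V" for V
    proof (rule ccontr)
      assume nontriv: "\<not> (V = {} \<or> V = U)"
      have "V \<subseteq> U" using V(1) by (rule openin_imp_subset)
      moreover have "openin Y V" "closedin Y V"
        using V clopen[OF U] openin_trans_full closedin_trans_full by blast+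
      ultimately show False
        using clopen_partition_split[OF P U, of V] max nontriv by fastforce
    qed
    then have "connected_space (subtopology Y U)"
      using openin_subset[OF clopen(1)[OF U]]
      by (auto simp: connected_space_clopen_in topspace_subtopology_subset)
    then show ?thesis using clopen[OF U] by (simp add: connectedin_def openin_subset)
  qed
  have "connected_components_of Y \<subseteq> P"
  proof
    fix C assume C: "C \<in> connected_components_of Y"
    then obtain x where x: "x \<in> C" "x \<in> topspace Y"
      by (metis connected_components_of_subset nonempty_connected_components_of ex_in_conv subsetD)
    then obtain U where U: "U \<in> P" "x \<in> U" using P by (auto simp: clopen_partition_def)
    have "C \<subseteq> U"
      using connectedin_clopen_cases[OF connectedin_connected_components_of[OF C] clopen(2,1)[OF U(1)]] x U
      by (auto simp: disjnt_iff)
    moreover have "U \<subseteq> C"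
      using connected_components_of_maximal[OF C conn[OF U(1)]] x U by (auto simp: disjnt_iff)
    ultimately have "C = U" by (rule subset_antisym)
    then show "C \<in> P" using U(1) by simp
  qed
  moreover have "finite P" using P by (simp add: clopen_partition_def)
  ultimately show ?thesis
    using bound[OF P] card_mono[of P "connected_components_of Y"] finite_subset by fastforce
qed

text \<open>Separate each \<open>p\<close> from the union of the others by \<open>V p\<close> and \<open>W p\<close>; cutting \<open>V p\<close> down to the
  sets \<open>W q\<close> of the other members makes the neighbourhoods pairwise disjoint.\<close>

lemma normal_space_separate_finite:
  assumes "normal_space Y" "finite P" "pairwise disjnt P" "\<And>p. p \<in> P \<Longrightarrow> closedin Y p"
  obtains U where "\<And>p. p \<in> P \<Longrightarrow> openin Y (U p)" "\<And>p. p \<in> P \<Longrightarrow> p \<subseteq> U p" "disjoint_family_on U P"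
proof -
  have "\<exists>V W. openin Y V \<and> openin Y W \<and> p \<subseteq> V \<and> \<Union>(P - {p}) \<subseteq> W \<and> disjnt V W" if "p \<in> P" for p
  proof -
    have "closedin Y (\<Union>(P - {p}))" using assms by (intro closedin_Union) auto
    moreover have "disjnt p (\<Union>(P - {p}))" using assms(3) that by (auto simp: disjnt_def pairwise_def)
    ultimately show ?thesis using assms(1,4) that unfolding normal_space_def by blast
  qed
  then obtain V W where VW: "openin Y (V p)" "openin Y (W p)" "p \<subseteq> V p" "\<Union>(P - {p}) \<subseteq> W p"
      "disjnt (V p) (W p)" if "p \<in> P" for p
    by metis
  define U where "U = (\<lambda>p. V p \<inter> (\<Inter>q\<in>P - {p}. W q))"
  show thesis
  proof (rule that[of U])
    fix p assume p: "p \<in> P"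
    show "openin Y (U p)"
    proof (cases "P - {p} = {}")
      case True
      show ?thesis unfolding U_def True using VW(1)[OF p] by simp
    next
      case False
      then have "openin Y (\<Inter>q\<in>P - {p}. W q)"
        using assms(2) VW(2) by (intro openin_Inter) auto
      then show ?thesis using VW(1)[OF p] by (auto simp: U_def)
    qed
    show "p \<subseteq> U p" using VW(3,4) p unfolding U_def by blast
  next
    show "disjoint_family_on U P"
      using VW(5) unfolding disjoint_family_on_def U_def disjnt_def by blast
  qed
qed

section \<open>Sequential lower semicontinuity in metrizable spaces\<close>

lemma metrizable_closure_of_sequentially:
  assumes "metrizable_space Y" "x \<in> Y closure_of A"
  obtains s where "\<And>n. s n \<in> A" "limitin Y s x sequentially"
proof -
  obtain M d where "Metric_space M d" "Y = Metric_space.mtopology M d"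
    using assms(1) unfolding metrizable_space_def by blast
  then have "\<exists>s. range s \<subseteq> A \<inter> M \<and> limitin Y s x sequentially"
    using assms(2) by (simp add: Metric_space.closure_of_sequentially)
  then obtain s where "range s \<subseteq> A" "limitin Y s x sequentially" by blast
  then show thesis by (intro that) auto
qed

lemma closedin_sublevel:
  assumes Y: "metrizable_space Y" and F: "seq_lsc Y F"
  shows "closedin Y {x \<in> topspace Y. F x \<le> c}" (is "closedin Y ?S")
proof -
  have "Y closure_of ?S \<subseteq> ?S"
  proof
    fix x assume x: "x \<in> Y closure_of ?S"
    then obtain s where s: "\<And>n. s n \<in> ?S" "limitin Y s x sequentially"
      using metrizable_closure_of_sequentially[OF Y x] by blast
    then have "F x \<le> liminf (\<lambda>n. F (s n))" using F unfolding seq_lsc_def by blast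
    also have "\<dots> \<le> liminf (\<lambda>n. c)" using s(1) by (intro Liminf_mono) simp
    finally have "F x \<le> c" by (simp add: Liminf_const)
    then show "x \<in> ?S" using s(2) by (simp add: limitin_topspace)
  qed
  then show ?thesis
    by (metis (no_types, lifting) closure_of_subset_eq mem_Collect_eq subsetI)
qed

text \<open>The sublevel sets \<open>{F \<le> F y}\<close> for \<open>y \<in> D\<close> have the finite intersection property in \<open>D\<close>,
  because among finitely many \<open>y\<close> one has the least value. A common point is a minimiser.\<close>

lemma compactin_attains_min:
  fixes F :: "'a \<Rightarrow> ereal"
  assumes D: "compactin Y D" "D \<noteq> {}" and F: "\<And>c. closedin Y {x \<in> topspace Y. F x \<le> c}"
  obtains x where "x \<in> D" "\<And>y. y \<in> D \<Longrightarrow> F x \<le> F y"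
proof -
  define \<U> where "\<U> = (\<lambda>y. {x \<in> topspace Y. F x \<le> F y}) ` D"
  have "D \<inter> \<Inter>\<F> \<noteq> {}" if \<F>: "finite \<F>" "\<F> \<subseteq> \<U>" for \<F>
  proof -
    obtain E where E: "E \<subseteq> D" "finite E" "\<F> = (\<lambda>y. {x \<in> topspace Y. F x \<le> F y}) ` E"
      using finite_subset_image[OF \<F>[unfolded \<U>_def]] by auto
    show ?thesis
    proof (cases "E = {}")
      case False
      then obtain m where m: "m \<in> E" "\<And>y. y \<in> E \<Longrightarrow> F m \<le> F y"
        using arg_min_if_finite[OF E(2), of F] by (metis linorder_not_le)
      then have "m \<in> D \<inter> \<Inter>\<F>"
        using E compactin_subset_topspace[OF D(1)] by auto
      then show ?thesis by blast
    qed (use D E in simp)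
  qed
  moreover have "\<forall>C\<in>\<U>. closedin Y C" using F by (auto simp: \<U>_def)
  ultimately have "D \<inter> \<Inter>\<U> \<noteq> {}"
    using D(1) unfolding compactin_fip by simp
  then obtain x where "x \<in> D" "x \<in> \<Inter>\<U>" by blast
  then show thesis by (intro that) (auto simp: \<U>_def)
qed

lemma seq_lsc_subtopology_mono:
  assumes "seq_lsc (subtopology T X) F" "C \<subseteq> X"
  shows "seq_lsc (subtopology T C) F"
  using assms unfolding seq_lsc_def limitin_subtopology
  by (auto elim!: eventually_mono)

section \<open>Sublevel sets with compact closure\<close>

text \<open>The variational argument uses only compactness and metrizability of the closure of the sublevel set
  at height \<open>r\<close>, so it is carried out in an arbitrary topology.\<close>

locale compact_sublevel =
  fixes T :: "'a topology" and X :: "'a set" and \<Psi> :: "'a \<Rightarrow> ereal" and r :: real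
  assumes X_closed: "seq_closedin T X"
    and lsc: "seq_lsc (subtopology T X) \<Psi>"
    and compact_closure: "compactin T (T closure_of {x \<in> X. \<Psi> x < ereal r})"
    and metrizable_closure: "metrizable_space (subtopology T (T closure_of {x \<in> X. \<Psi> x < ereal r}))"
begin

definition sublevel :: "real \<Rightarrow> 'a set" where
  "sublevel \<rho> = {x \<in> X. \<Psi> x < ereal \<rho>}"

definition sublevel_closure :: "real \<Rightarrow> 'a set" where
  "sublevel_closure \<rho> = T closure_of sublevel \<rho>"

lemma sublevel_subset_closure: "sublevel \<rho> \<subseteq> sublevel_closure \<rho>"
  unfolding sublevel_closure_def sublevel_def using X_closed by (intro closure_of_subset) (auto simp: seq_closedin_def)

lemma closedin_sublevel_closure: "closedin T (sublevel_closure \<rho>)"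
  by (simp add: sublevel_closure_def)

lemma sublevel_closure_mono: "\<rho> \<le> r \<Longrightarrow> sublevel_closure \<rho> \<subseteq> sublevel_closure r"
  unfolding sublevel_closure_def sublevel_def by (intro closure_of_mono) (auto intro: less_le_trans)

lemma compactin_sublevel_closure: "compactin T (sublevel_closure r)"
  using compact_closure by (simp add: sublevel_closure_def sublevel_def)

lemma metrizable_sublevel_closure: "metrizable_space (subtopology T (sublevel_closure r))"
  using metrizable_closure by (simp add: sublevel_closure_def sublevel_def)

lemma topspace_sublevel_closure: "topspace (subtopology T (sublevel_closure \<rho>)) = sublevel_closure \<rho>"
  by (rule topspace_subtopology_subset[OF closedin_subset[OF closedin_sublevel_closure]])

text \<open>In general a sequentially closed set need not be closed, but metrizability makes every point of the
  closure of \<open>{\<Psi> < r}\<close> the limit of a sequence from this set.\<close>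

lemma sublevel_closure_subset: "sublevel_closure r \<subseteq> X"
proof
  fix x assume x: "x \<in> sublevel_closure r"
  have "subtopology T (sublevel_closure r) closure_of sublevel r = sublevel_closure r \<inter> T closure_of sublevel r"
    using sublevel_subset_closure closure_of_subtopology by (metis inf.absorb_iff2)
  then have "x \<in> subtopology T (sublevel_closure r) closure_of sublevel r"
    using x by (simp add: sublevel_closure_def)
  then obtain s where s: "\<And>n. s n \<in> sublevel r" "limitin (subtopology T (sublevel_closure r)) s x sequentially"
    using metrizable_closure_of_sequentially[OF metrizable_sublevel_closure] by metis
  then have "limitin T s x sequentially" "\<forall>n. s n \<in> X"
    by (auto simp: limitin_subtopology sublevel_def)
  then show "x \<in> X" using X_closed unfolding seq_closedin_def by blast
qed

lemma closedin_le_in_closure: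
  assumes "seq_lsc (subtopology T X) F"
  shows "closedin T {x \<in> sublevel_closure r. F x \<le> c}"
  using closedin_sublevel[OF metrizable_sublevel_closure seq_lsc_subtopology_mono[OF assms sublevel_closure_subset], of c]
    closedin_trans_full[OF _ closedin_sublevel_closure] by (simp only: topspace_sublevel_closure)

lemma attains_min:
  assumes F: "seq_lsc (subtopology T X) F" and D: "closedin T D" "D \<subseteq> sublevel_closure r" "D \<noteq> {}"
  obtains x where "x \<in> D" "\<And>y. y \<in> D \<Longrightarrow> F x \<le> F y"
proof -
  have "compactin (subtopology T (sublevel_closure r)) D"
    using closed_compactin[OF compactin_sublevel_closure D(2,1)] D(2) by (simp add: compactin_subtopology)
  then show thesis
  proof (rule compactin_attains_min[OF _ D(3)])
    show "closedin (subtopology T (sublevel_closure r)) {x \<in> topspace (subtopology T (sublevel_closure r)). F x \<le> c}" for c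
      by (rule closedin_sublevel[OF metrizable_sublevel_closure seq_lsc_subtopology_mono[OF F sublevel_closure_subset]])
  qed (use that in blast)
qed

text \<open>The inequality \<open>\<Psi> \<le> \<rho>\<close> passes from \<open>{\<Psi> < \<rho>}\<close> to its closure by lower semicontinuity.\<close>

lemma sublevel_closure_le: "\<rho> \<le> r \<Longrightarrow> x \<in> sublevel_closure \<rho> \<Longrightarrow> \<Psi> x \<le> ereal \<rho>"
proof -
  assume \<rho>: "\<rho> \<le> r" and x: "x \<in> sublevel_closure \<rho>"
  have "sublevel \<rho> \<subseteq> {x \<in> sublevel_closure r. \<Psi> x \<le> ereal \<rho>}"
    using sublevel_subset_closure sublevel_closure_mono[OF \<rho>] by (auto simp: sublevel_def)
  then have "sublevel_closure \<rho> \<subseteq> {x \<in> sublevel_closure r. \<Psi> x \<le> ereal \<rho>}"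
    unfolding sublevel_closure_def[of \<rho>] using closedin_le_in_closure[OF lsc] by (rule closure_of_minimal)
  then show ?thesis using x by blast
qed

text \<open>A set open in the closure of \<open>{\<Psi> < \<rho>}\<close> need not be open in \<open>X\<close>, but it becomes so, in the
  topology refined by the sublevel sets of \<open>\<Psi>\<close>, after intersection with \<open>{\<Psi> < \<rho>}\<close>. This is why
  the refined topology is the right one for counting local minima.\<close>

lemma local_min_on_piece:
  assumes \<rho>: "\<rho> \<le> r" and V: "openin (subtopology T (sublevel_closure \<rho>)) V"
    and x: "x \<in> V" "\<Psi> x < ereal \<rho>" "\<And>y. y \<in> V \<Longrightarrow> F x \<le> F y"
  shows "local_min_in (sublevel_top (subtopology T X) \<Psi>) F x"
proof -
  obtain W where W: "openin T W" "V = W \<inter> sublevel_closure \<rho>"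
    using V by (auto simp: openin_subtopology)
  have XT: "topspace (subtopology T X) = X"
    using X_closed by (auto simp: seq_closedin_def)
  have "openin (sublevel_top (subtopology T X) \<Psi>) (W \<inter> X)"
    unfolding sublevel_top_def using W(1) by (intro topology_generated_by_Basis) (auto simp: openin_subtopology)
  moreover have "openin (sublevel_top (subtopology T X) \<Psi>) (sublevel \<rho>)"
    unfolding sublevel_top_def sublevel_def by (intro topology_generated_by_Basis) (use XT in auto)
  ultimately have "openin (sublevel_top (subtopology T X) \<Psi>) ((W \<inter> X) \<inter> sublevel \<rho>)"
    by (rule openin_Int)
  moreover have "x \<in> (W \<inter> X) \<inter> sublevel \<rho>"
    using x W sublevel_closure_mono[OF \<rho>] sublevel_closure_subset by (auto simp: sublevel_def)
  moreover have "F x \<le> F y" if "y \<in> (W \<inter> X) \<inter> sublevel \<rho>" for y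
    using that x(3) W(2) sublevel_subset_closure by blast
  ultimately show ?thesis unfolding local_min_in_def by blast
qed

end

locale perturbed_sublevel = compact_sublevel +
  fixes \<Phi> :: "'a \<Rightarrow> real" and \<mu> :: "nat \<Rightarrow> real" and k :: nat
  assumes not_MInfty: "x \<in> X \<Longrightarrow> \<Psi> x \<noteq> -\<infinity>"
    and \<Phi>_bdd: "bdd_below (\<Phi> ` sublevel_closure r)"
    and \<mu>_pos: "\<mu> n > 0"
    and \<mu>_lim: "\<mu> \<longlonglongrightarrow> 0"
    and sum_lsc: "\<forall>\<^sub>F n in sequentially. seq_lsc (subtopology T X) (\<lambda>x. \<Psi> x + ereal (\<mu> n * \<Phi> x))"
    and finite_minima: "finite {x \<in> sublevel r. local_min_in (sublevel_top (subtopology T X) \<Psi>)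
                (\<lambda>y. \<Psi> y + ereal (\<mu> n * \<Phi> y)) x}"
    and card_minima: "card {x \<in> sublevel r. local_min_in (sublevel_top (subtopology T X) \<Psi>)
                (\<lambda>y. \<Psi> y + ereal (\<mu> n * \<Phi> y)) x} \<le> k"
begin

text \<open>The perturbation \<open>\<mu>\<^sub>n \<Phi>\<close> is eventually too weak to push the minimiser over the piece up to the
  level \<open>\<rho>\<close>, because the piece contains a point strictly below \<open>\<rho>\<close>.\<close>

lemma local_min_in_piece:
  assumes \<rho>: "\<rho> \<le> r"
    and V: "openin (subtopology T (sublevel_closure \<rho>)) V" "closedin (subtopology T (sublevel_closure \<rho>)) V" "V \<noteq> {}"
  shows "\<forall>\<^sub>F n in sequentially. \<exists>x \<in> V \<inter> sublevel \<rho>. local_min_in (sublevel_top (subtopology T X) \<Psi>)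
                (\<lambda>y. \<Psi> y + ereal (\<mu> n * \<Phi> y)) x"
proof -
  have VC: "V \<subseteq> sublevel_closure \<rho>" using V(1) openin_imp_subset by blast
  then have Vr: "V \<subseteq> sublevel_closure r" using sublevel_closure_mono[OF \<rho>] by blast
  have clV: "closedin T V" using closedin_trans_full[OF V(2) closedin_sublevel_closure] .
  obtain b where b: "\<And>x. x \<in> sublevel_closure r \<Longrightarrow> b \<le> \<Phi> x"
    using \<Phi>_bdd by (auto simp: bdd_below_def)
  obtain a where a: "a \<in> V" "a \<in> sublevel \<rho>"
  proof -
    obtain W where W: "openin T W" "V = W \<inter> sublevel_closure \<rho>" using V(1) by (auto simp: openin_subtopology)
    then obtain z where "z \<in> W" "z \<in> T closure_of sublevel \<rho>" using V(3) by (auto simp: sublevel_closure_def)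
    then obtain a where "a \<in> sublevel \<rho>" "a \<in> W" using W(1) unfolding in_closure_of by blast
    then show thesis using that W sublevel_subset_closure by blast
  qed
  obtain \<alpha> where \<alpha>: "\<Psi> a = ereal \<alpha>" "\<alpha> < \<rho>"
    using a(2) not_MInfty[of a] by (cases "\<Psi> a") (auto simp: sublevel_def)
  have "(\<lambda>n. \<mu> n * (\<Phi> a - b)) \<longlonglongrightarrow> 0 * (\<Phi> a - b)"
    by (intro tendsto_mult \<mu>_lim tendsto_const)
  then have "\<forall>\<^sub>F n in sequentially. \<mu> n * (\<Phi> a - b) < \<rho> - \<alpha>"
    using \<alpha>(2) by (intro order_tendstoD(2)) auto
  with sum_lsc show ?thesis
  proof eventually_elim
    case (elim n)
    obtain x where x: "x \<in> V" and min: "\<And>y. y \<in> V \<Longrightarrow> \<Psi> x + ereal (\<mu> n * \<Phi> x) \<le> \<Psi> y + ereal (\<mu> n * \<Phi> y)"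
      using attains_min[OF elim(1) clV Vr V(3)] by blast
    have "\<mu> n * b \<le> \<mu> n * \<Phi> x"
      using b[of x] x Vr \<mu>_pos[of n] by (auto intro: mult_left_mono less_imp_le)
    with elim(2) have "\<alpha> + \<mu> n * \<Phi> a < \<rho> + \<mu> n * \<Phi> x"
      by (simp add: algebra_simps)
    moreover have "\<Psi> x + ereal (\<mu> n * \<Phi> x) \<le> ereal (\<alpha> + \<mu> n * \<Phi> a)"
      using min[OF a(1)] \<alpha>(1) by simp
    ultimately have lt: "\<Psi> x < ereal \<rho>"
      by (cases "\<Psi> x") auto
    then have "x \<in> sublevel \<rho>" using x Vr sublevel_closure_subset by (auto simp: sublevel_def)
    then show ?case
      using local_min_on_piece[where F = "\<lambda>y. \<Psi> y + ereal (\<mu> n * \<Phi> y)", OF \<rho> V(1) x lt min] x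
      by blast
  qed
qed

text \<open>Finitely many pieces admit a common index \<open>n\<close>, and disjointness makes their local minima distinct.\<close>

lemma card_pieces_le:
  assumes \<rho>: "\<rho> \<le> r" and I: "finite I" and disj: "disjoint_family_on V I"
    and V: "\<And>i. i \<in> I \<Longrightarrow> openin (subtopology T (sublevel_closure \<rho>)) (V i)"
      "\<And>i. i \<in> I \<Longrightarrow> closedin (subtopology T (sublevel_closure \<rho>)) (V i)" "\<And>i. i \<in> I \<Longrightarrow> V i \<noteq> {}"
  shows "card I \<le> k"
proof -
  define M where "M = (\<lambda>n. {x \<in> sublevel r. local_min_in (sublevel_top (subtopology T X) \<Psi>)
                (\<lambda>y. \<Psi> y + ereal (\<mu> n * \<Phi> y)) x})"
  have sub: "sublevel \<rho> \<subseteq> sublevel r" using \<rho> by (auto simp: sublevel_def intro: less_le_trans)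
  have "\<forall>\<^sub>F n in sequentially. \<exists>x. x \<in> V i \<inter> M n" if "i \<in> I" for i
    using local_min_in_piece[OF \<rho> V[OF that]]
    by (rule eventually_mono) (use sub in \<open>auto simp: M_def\<close>)
  then have "\<forall>\<^sub>F n in sequentially. \<forall>i\<in>I. \<exists>x. x \<in> V i \<inter> M n"
    by (intro eventually_ball_finite I) blast
  then obtain n where "\<forall>i\<in>I. \<exists>x. x \<in> V i \<inter> M n"
    using eventually_happens'[OF sequentially_bot] by blast
  then obtain m where m: "\<And>i. i \<in> I \<Longrightarrow> m i \<in> V i \<inter> M n"
    by metis
  have "inj_on m I"
  proof (rule inj_onI)
    fix i j assume ij: "i \<in> I" "j \<in> I" "m i = m j"
    then have "m i \<in> V i \<inter> V j" using m[of i] m[of j] by auto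
    then show "i = j" using disj ij unfolding disjoint_family_on_def by blast
  qed
  then have "card I \<le> card (M n)"
    using m finite_minima[of n] unfolding M_def by (intro card_inj_on_le[of m]) auto
  also have "\<dots> \<le> k" using card_minima[of n] by (simp add: M_def)
  finally show ?thesis .
qed

theorem components_closure:
  assumes \<rho>: "\<rho> \<le> r"
  shows "finite (connected_components_of (subtopology T (sublevel_closure \<rho>))) \<and>
    card (connected_components_of (subtopology T (sublevel_closure \<rho>))) \<le> k"
proof (rule card_components_le)
  fix P assume P: "clopen_partition (subtopology T (sublevel_closure \<rho>)) P"
  then have "disjoint_family_on (\<lambda>U. U) P"
    by (auto simp: clopen_partition_def disjoint_family_on_def pairwise_def disjnt_def)
  then show "card P \<le> k"
    using card_pieces_le[OF \<rho>, of P "\<lambda>U. U"] P by (simp add: clopen_partition_def)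
qed

text \<open>A finite clopen partition of the set of minimisers is thickened to one of the closure of
  \<open>{\<Psi> < \<rho>}\<close> for some \<open>\<rho>\<close> slightly above the infimum.\<close>

theorem components_minimisers:
  assumes r: "(INF x\<in>X. \<Psi> x) < ereal r"
  defines "S \<equiv> {x \<in> X. \<Psi> x = (INF y\<in>X. \<Psi> y)}"
  shows "finite (connected_components_of (subtopology T S)) \<and>
    card (connected_components_of (subtopology T S)) \<le> k"
proof (rule card_components_le)
  fix P assume P: "clopen_partition (subtopology T S) P"
  have S_A: "S \<subseteq> sublevel \<rho>" if "(INF x\<in>X. \<Psi> x) < ereal \<rho>" for \<rho>
    using that by (auto simp: S_def sublevel_def)
  have S_C: "S \<subseteq> sublevel_closure r" using S_A[OF r] sublevel_subset_closure by blast
  have "S = {x \<in> sublevel_closure r. \<Psi> x \<le> (INF y\<in>X. \<Psi> y)}"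
    using S_C sublevel_closure_subset by (auto simp: S_def intro: antisym INF_lower)
  then have S_closed: "closedin T S"
    using closedin_le_in_closure[OF lsc] by simp
  have P_S: "p \<subseteq> S" if "p \<in> P" for p
    using P that by (meson clopen_partition_def openin_imp_subset)
  have P_closed: "closedin (subtopology T (sublevel_closure r)) p" if "p \<in> P" for p
  proof -
    have "closedin T p"
      using P that closedin_trans_full[OF _ S_closed] by (auto simp: clopen_partition_def)
    then show ?thesis using P_S[OF that] S_C by (meson closedin_subset_topspace subset_trans)
  qed
  have P': "finite P" "pairwise disjnt P" using P by (auto simp: clopen_partition_def)
  obtain U where U: "\<And>p. p \<in> P \<Longrightarrow> openin (subtopology T (sublevel_closure r)) (U p)"
      "\<And>p. p \<in> P \<Longrightarrow> p \<subseteq> U p" "disjoint_family_on U P"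
    using normal_space_separate_finite[OF metrizable_imp_normal_space[OF metrizable_sublevel_closure] P' P_closed]
    by metis
  \<comment> \<open>the part of the closure that the neighbourhoods miss: \<open>\<Psi>\<close> stays away from its infimum there\<close>
  define D where "D = sublevel_closure r - \<Union>(U ` P)"
  have "openin (subtopology T (sublevel_closure r)) (\<Union>(U ` P))" using U(1) by (intro openin_Union) auto
  then have "closedin (subtopology T (sublevel_closure r)) (topspace (subtopology T (sublevel_closure r)) - \<Union>(U ` P))"
    by (intro closedin_diff closedin_topspace)
  then have D: "closedin T D" "D \<subseteq> sublevel_closure r"
    using closedin_trans_full[OF _ closedin_sublevel_closure] unfolding topspace_sublevel_closure D_def by blast+
  have S_cover: "S \<subseteq> \<Union>(U ` P)"
  proof -
    have "\<Union>P = S"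
      using P topspace_subtopology_subset[OF closedin_subset[OF S_closed]]
      by (simp add: clopen_partition_def)
    then show ?thesis using U(2) by blast
  qed
  obtain \<rho> where \<rho>: "(INF x\<in>X. \<Psi> x) < ereal \<rho>" "\<rho> \<le> r" "sublevel_closure \<rho> \<inter> D = {}"
  proof (cases "D = {}")
    case True
    then show thesis using that[of r] r by simp
  next
    case False
    then obtain x where x: "x \<in> D" and min: "\<And>y. y \<in> D \<Longrightarrow> \<Psi> x \<le> \<Psi> y"
      using attains_min[OF lsc D] by blast
    have xX: "x \<in> X" using x D sublevel_closure_subset by blast
    then have "\<Psi> x \<noteq> (INF y\<in>X. \<Psi> y)" using x S_cover by (auto simp: D_def S_def)
    then have "(INF y\<in>X. \<Psi> y) < \<Psi> x" using INF_lower[OF xX, of \<Psi>] by simp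
    with r have "(INF y\<in>X. \<Psi> y) < min (\<Psi> x) (ereal r)" by simp
    then obtain \<rho> where \<rho>: "(INF y\<in>X. \<Psi> y) < ereal \<rho>" "ereal \<rho> < min (\<Psi> x) (ereal r)"
      using ereal_dense2 by blast
    have \<rho>r: "\<rho> \<le> r" using \<rho>(2) by simp
    have "y \<notin> D" if "y \<in> sublevel_closure \<rho>" for y
      using sublevel_closure_le[OF \<rho>r that] min[of y] \<rho>(2) by auto
    then show thesis using that[of \<rho>] \<rho>(1) \<rho>r by blast
  qed
  have C_cover: "sublevel_closure \<rho> \<subseteq> \<Union>(U ` P)"
    using \<rho>(3) sublevel_closure_mono[OF \<rho>(2)] by (auto simp: D_def)
  define V where "V = (\<lambda>p. sublevel_closure \<rho> \<inter> U p)"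
  have V_open: "openin (subtopology T (sublevel_closure \<rho>)) (V p)" if "p \<in> P" for p
  proof -
    have "openin (subtopology (subtopology T (sublevel_closure r)) (sublevel_closure \<rho>)) (sublevel_closure \<rho> \<inter> U p)"
      by (rule openin_subtopology_Int2[OF U(1)[OF that]])
    then show ?thesis
      using sublevel_closure_mono[OF \<rho>(2)] by (simp add: V_def subtopology_subtopology Int_absorb1)
  qed
  have V_closed: "closedin (subtopology T (sublevel_closure \<rho>)) (V p)" if "p \<in> P" for p
  proof -
    have "V p = topspace (subtopology T (sublevel_closure \<rho>)) - \<Union>(V ` (P - {p}))"
      using C_cover U(3) that unfolding topspace_sublevel_closure by (fastforce simp: V_def disjoint_family_on_def)
    moreover have "openin (subtopology T (sublevel_closure \<rho>)) (\<Union>(V ` (P - {p})))"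
      using V_open by (intro openin_Union) auto
    ultimately show ?thesis by (metis closedin_diff closedin_topspace)
  qed
  have V_ne: "V p \<noteq> {}" if "p \<in> P" for p
  proof -
    have "p \<subseteq> V p"
      using P_S[OF that] S_A[OF \<rho>(1)] sublevel_subset_closure[of \<rho>] U(2)[OF that] by (auto simp: V_def)
    then show ?thesis using P that by (auto simp: clopen_partition_def)
  qed
  have "disjoint_family_on V P"
    using U(3) by (auto simp: disjoint_family_on_def V_def)
  then show "card P \<le> k"
    using card_pieces_le[OF \<rho>(2) P'(1)] V_open V_closed V_ne by blast
qed

end

theorem theorem7:
  fixes X :: "'a::banach set"
    and k :: nat
    and \<Psi> :: "'a \<Rightarrow> ereal"
    and \<Phi> :: "'a \<Rightarrow> real"
    and r :: real
    and \<mu> :: "nat \<Rightarrow> real"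
  assumes reflexive: "reflexive_space TYPE('a)"
    and separable: "separable_space (euclidean :: 'a topology)"
    and X_closed: "seq_closedin weak_top X"
    and k_pos: "k > 0"
    and \<Psi>_range: "\<forall>x\<in>X. \<Psi> x \<noteq> -\<infinity>"
    and \<Psi>_lsc: "seq_lsc (subtopology weak_top X) \<Psi>"
    and r_gt: "ereal r > (INF x\<in>X. \<Psi> x)"
    and \<Psi>_bounded: "bounded {x \<in> X. \<Psi> x < ereal r}"
    and \<Phi>_bdd_below: "bdd_below (\<Phi> ` (weak_top closure_of {x \<in> X. \<Psi> x < ereal r}))"
    and \<mu>_pos: "\<forall>n. \<mu> n > 0"
    and \<mu>_lim: "\<mu> \<longlonglongrightarrow> 0"
    and sum_lsc: "\<exists>c>0. \<forall>t::real. 0 < t \<and> t \<le> c \<longrightarrow>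
            seq_lsc (subtopology weak_top X) (\<lambda>x. \<Psi> x + ereal (t * \<Phi> x))"
    and local_minima: "\<forall>n.
            finite {x \<in> X. \<Psi> x < ereal r \<and>
              local_min_in (sublevel_top (subtopology weak_top X) \<Psi>)
                (\<lambda>y. \<Psi> y + ereal (\<mu> n * \<Phi> y)) x} \<and>
            card {x \<in> X. \<Psi> x < ereal r \<and>
              local_min_in (sublevel_top (subtopology weak_top X) \<Psi>)
                (\<lambda>y. \<Psi> y + ereal (\<mu> n * \<Phi> y)) x} \<le> k"
  shows "\<forall>\<rho>::real. (INF x\<in>X. \<Psi> x) < ereal \<rho> \<and> \<rho> \<le> r \<longrightarrow>
      (\<forall>S \<in> {weak_top closure_of {x \<in> X. \<Psi> x < ereal \<rho>},
              {x \<in> X. \<Psi> x = (INF y\<in>X. \<Psi> y)}}.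
         finite (connected_components_of (subtopology weak_top S)) \<and>
         card (connected_components_of (subtopology weak_top S)) \<le> k \<and>
         (k = 1 \<longrightarrow> connectedin weak_top S))"
proof (intro allI impI ballI)
  fix \<rho> :: real and S
  assume \<rho>: "(INF x\<in>X. \<Psi> x) < ereal \<rho> \<and> \<rho> \<le> r"
    and S: "S \<in> {weak_top closure_of {x \<in> X. \<Psi> x < ereal \<rho>},
                 {x \<in> X. \<Psi> x = (INF y\<in>X. \<Psi> y)}}"
  define Ar where "Ar = {x \<in> X. \<Psi> x < ereal r}"
  obtain R where R: "\<And>x. x \<in> Ar \<Longrightarrow> norm x \<le> R"
    using \<Psi>_bounded by (auto simp: bounded_iff Ar_def)
  \<comment> \<open>the ball of radius \<open>R\<close>, described by the functionals so that its weak compactness is at hand\<close>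
  define K where "K = {x :: 'a. \<forall>f. \<bar>blinfun_apply f x\<bar> \<le> R * norm f}"
  have K: "compactin weak_top K"
    unfolding K_def by (rule compactin_weak_polar[OF reflexive])
  have "Ar \<subseteq> K"
  proof
    fix x assume x: "x \<in> Ar"
    have "\<bar>blinfun_apply f x\<bar> \<le> R * norm f" for f :: "'a \<Rightarrow>\<^sub>L real"
      using norm_blinfun[of f x] mult_left_mono[OF R[OF x] norm_ge_zero[of f]]
      by (simp add: mult.commute)
    then show "x \<in> K" by (simp add: K_def)
  qed
  then have "weak_top closure_of Ar \<subseteq> K"
    using compactin_imp_closedin[OF Hausdorff_weak_top K] by (rule closure_of_minimal)
  then have compact: "compactin weak_top (weak_top closure_of Ar)"
    using closed_compactin[OF K] by simp
  obtain c where c: "c > 0" "\<And>t. 0 < t \<Longrightarrow> t \<le> c \<Longrightarrow>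
      seq_lsc (subtopology weak_top X) (\<lambda>x. \<Psi> x + ereal (t * \<Phi> x))"
    using sum_lsc by blast
  interpret compact_sublevel weak_top X \<Psi> r
    using X_closed \<Psi>_lsc compact metrizable_weakly_compact[OF separable compact]
    by unfold_locales (simp_all add: Ar_def)
  interpret perturbed_sublevel weak_top X \<Psi> r \<Phi> \<mu> k
  proof unfold_locales
    show "\<forall>\<^sub>F n in sequentially. seq_lsc (subtopology weak_top X) (\<lambda>x. \<Psi> x + ereal (\<mu> n * \<Phi> x))"
      using order_tendstoD(2)[OF \<mu>_lim c(1)]
      by (rule eventually_mono) (use c(2) \<mu>_pos in auto)
  qed (use \<Psi>_range \<Phi>_bdd_below \<mu>_pos \<mu>_lim local_minima in \<open>auto simp: sublevel_def sublevel_closure_def conj_assoc\<close>)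
  have comps: "finite (connected_components_of (subtopology weak_top S)) \<and>
      card (connected_components_of (subtopology weak_top S)) \<le> k"
    using S components_closure[of \<rho>] components_minimisers[OF r_gt] \<rho> by (auto simp: sublevel_def sublevel_closure_def)
  moreover have "connectedin weak_top S" if "k = 1"
    using comps that card_le_Suc0_iff_eq[of "connected_components_of (subtopology weak_top S)"]
    by (simp add: connectedin_def connected_space_iff_components_eq)
  ultimately show "finite (connected_components_of (subtopology weak_top S)) \<and>
         card (connected_components_of (subtopology weak_top S)) \<le> k \<and>
         (k = 1 \<longrightarrow> connectedin weak_top S)"
    by blast
qed

end
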